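(* Let $\Sigma$ be an alphabet, and let $\mathcal R_\Sigma$ be the set of reduced pointed $\Sigma$-labelled rooted trees. Then the free $\operatorname{Rel}(;, +, {}^*, 0, 1, D)$-algebra over $\Sigma$ has as its universe all the regular subsets of $\mathcal R_\Sigma$, with operations (for regular $L, L_1, L_2$): $0 := \emptyset$; $1 := \{\mathbf 1\}$; $L_1 + L_2 := \operatorname{maximal}(L_1 \cup L_2)$; $L_1 ; L_2 := \operatorname{maximal}(L_1 ; L_2)$; $L^* := \operatorname{maximal}(\bigcup_{i=1}^\infty L^i)$ where $L^0 := \{\mathbf 1\}$ and $L^{i+1} := L^i ; L$; $D(L) := \operatorname{maximal}(D(L))$.
   Context: $\operatorname{Rel}(;,+,{}^*,0,1,D)$ is the isomorphic closure of the class of algebras of binary relations with composition, union, reflexive transitive closure, empty relation, identity relation and domain $D(R)=\{(x,x):\exists y\,(x,y)\in R\}$. A $\Sigma$-labelled rooted tree is recursively a finite set of pairs $(a,T)$ with $a\in\Sigma$ and $T$ such a tree; a pointed tree has a distinguished vertex (the point). $T_1\le T_2$ iff there is a homomorphism $T_2\to T_1$ of labelled trees preserving root and point; this is a partial order on reduced trees, where the reduced form recursively reduces the root's child subtrees and keeps, for each label, only the $\le$-minimal child subtrees attached by that label. For reduced pointed trees, $T;S$ identifies the point of $T$ with the root of $S$ and reduces; $D(T)$ moves the point to the root and reduces; both lifted to sets elementwise. $\operatorname{maximal}(K)$ is the set of $\le$-maximal elements of $K$. $\mathbf 1$ is the one-vertex pointed tree, $\vec a$ the two-vertex tree with one $a$-labelled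 edge and point at the child. The standard tree interpretation $[\![\cdot]\!]$ of $\{;,+,{}^*,0,1,D\}$-terms is $[\![a]\!]=\{\vec a\}$, $[\![0]\!]=\emptyset$, $[\![1]\!]=\{\mathbf1\}$, and $[\![\cdot]\!]$ commutes with the operations listed in the claim. A set of pointed trees is regular if it equals $[\![t]\!]$ for some $\{;,+,{}^*,0,1,D\}$-term $t$.
   Formalization: The union defining L* is taken from i=0 instead of i=1: with i=1 one gets 0* = ∅ = 0, whereas 0* = 1 holds in every algebra of Rel(;,+,*,0,1,D), so the printed formula is false. *)

theory Defs
  imports Main "HOL-Library.FSet" "HOL-Library.FuncSet"
begin

section \<open>Labelled rooted trees with marked vertices\<close>

text \<open>
  Every vertex carries a Boolean mark. A plain tree has no marked vertex; a pointed tree has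
  exactly one, its point. Since the mark is part of the data, a child subtree that
  contains the point is distinguished from an otherwise equal one that does not.
\<close>

datatype (labels: 'a) ltree = Node (mark: bool) (children: "('a \<times> 'a ltree) fset")

text \<open>
  A vertex is identified with the sequence of edges, each given by its label and the subtree
  hanging from it, that leads to it from the root.
\<close>

primrec is_vertex :: "'a ltree \<Rightarrow> ('a \<times> 'a ltree) list \<Rightarrow> bool" where
  "is_vertex T [] \<longleftrightarrow> True"
| "is_vertex T (e # p) \<longleftrightarrow> e |\<in>| children T \<and> is_vertex (snd e) p"

primrec subtree_at :: "'a ltree \<Rightarrow> ('a \<times> 'a ltree) list \<Rightarrow> 'a ltree" where
  "subtree_at T [] = T"
| "subtree_at T (e # p) = subtree_at (snd e) p"

definition vertices :: "'a ltree \<Rightarrow> ('a \<times> 'a ltree) list set" where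
  "vertices T = {p. is_vertex T p}"

definition edges ::
  "'a ltree \<Rightarrow> (('a \<times> 'a ltree) list \<times> 'a \<times> ('a \<times> 'a ltree) list) set" where
  "edges T = {(p, a, p @ [(a, S)]) | p a S. p @ [(a, S)] \<in> vertices T}"

definition points :: "'a ltree \<Rightarrow> ('a \<times> 'a ltree) list set" where
  "points T = {p \<in> vertices T. mark (subtree_at T p)}"

definition pointed :: "'a ltree \<Rightarrow> bool" where
  "pointed T \<longleftrightarrow> (\<exists>!p. p \<in> points T)"

definition tree_hom ::
  "(('a \<times> 'a ltree) list \<Rightarrow> ('a \<times> 'a ltree) list) \<Rightarrow> 'a ltree \<Rightarrow> 'a ltree \<Rightarrow> bool" where
  "tree_hom f T S \<longleftrightarrow>
     f \<in> vertices T \<rightarrow> vertices S \<and>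
     f [] = [] \<and>
     (\<forall>(p, a, q) \<in> edges T. (f p, a, f q) \<in> edges S) \<and>
     f \<in> points T \<rightarrow> points S"

definition tree_le :: "'a ltree \<Rightarrow> 'a ltree \<Rightarrow> bool"  (infix "\<preceq>" 50) where
  "T\<^sub>1 \<preceq> T\<^sub>2 \<longleftrightarrow> (\<exists>f. tree_hom f T\<^sub>2 T\<^sub>1)"

definition minimal_children :: "('a \<times> 'a ltree) fset \<Rightarrow> ('a \<times> 'a ltree) fset" where
  "minimal_children C =
     ffilter (\<lambda>(a, T). \<not> (\<exists>S. (a, S) |\<in>| C \<and> S \<preceq> T \<and> S \<noteq> T)) C"

primrec reduce :: "'a ltree \<Rightarrow> 'a ltree" where
  "reduce (Node b C) = Node b (minimal_children (fimage (map_prod id reduce) C))"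

definition reduced :: "'a ltree \<Rightarrow> bool" where
  "reduced T \<longleftrightarrow> reduce T = T"

definition reduced_ptrees :: "'a set \<Rightarrow> 'a ltree set"  ("\<R>") where
  "\<R> \<Sigma> = {T. labels T \<subseteq> \<Sigma> \<and> pointed T \<and> reduced T}"


section \<open>Operations on pointed trees\<close>

definition tree_one :: "'a ltree" where
  "tree_one = Node True {||}"

definition tree_letter :: "'a \<Rightarrow> 'a ltree" where
  "tree_letter a = Node False {|(a, Node True {||})|}"

text \<open>
  In the next two definitions, forming sets of children may merge equal siblings that
  should be different vertices. One of them would be removed by the subsequent reduction anyway.
\<close>

primrec glue :: "'a ltree \<Rightarrow> 'a ltree \<Rightarrow> 'a ltree" where
  "glue S (Node b C) =
     (let C' = fimage (map_prod id (glue S)) C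
      in if b then Node (mark S) (C' |\<union>| children S) else Node False C')"

primrec unmark :: "'a ltree \<Rightarrow> 'a ltree" where
  "unmark (Node b C) = Node False (fimage (map_prod id unmark) C)"

definition tree_comp :: "'a ltree \<Rightarrow> 'a ltree \<Rightarrow> 'a ltree" where
  "tree_comp T S = reduce (glue S T)"

definition tree_dom :: "'a ltree \<Rightarrow> 'a ltree" where
  "tree_dom T = reduce (Node True (children (unmark T)))"


section \<open>Operations on sets of pointed trees\<close>

definition maximal :: "'a ltree set \<Rightarrow> 'a ltree set" where
  "maximal K = {T \<in> K. \<not> (\<exists>S \<in> K. T \<preceq> S \<and> S \<noteq> T)}"

definition set_comp :: "'a ltree set \<Rightarrow> 'a ltree set \<Rightarrow> 'a ltree set" where
  "set_comp L\<^sub>1 L\<^sub>2 = {tree_comp T S | T S. T \<in> L\<^sub>1 \<and> S \<in> L\<^sub>2}"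

primrec set_power :: "'a ltree set \<Rightarrow> nat \<Rightarrow> 'a ltree set" where
  "set_power L 0 = {tree_one}"
| "set_power L (Suc i) = set_comp (set_power L i) L"

definition lang_plus :: "'a ltree set \<Rightarrow> 'a ltree set \<Rightarrow> 'a ltree set" where
  "lang_plus L\<^sub>1 L\<^sub>2 = maximal (L\<^sub>1 \<union> L\<^sub>2)"

definition lang_comp :: "'a ltree set \<Rightarrow> 'a ltree set \<Rightarrow> 'a ltree set" where
  "lang_comp L\<^sub>1 L\<^sub>2 = maximal (set_comp L\<^sub>1 L\<^sub>2)"

text \<open>
  The union must include the power 0: otherwise the star of the empty set would be empty, whereas
  the reflexive transitive closure of the empty relation is the identity.
\<close>

definition lang_star :: "'a ltree set \<Rightarrow> 'a ltree set" where
  "lang_star L = maximal (\<Union>i. set_power L i)"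

definition lang_dom :: "'a ltree set \<Rightarrow> 'a ltree set" where
  "lang_dom L = maximal (tree_dom ` L)"


section \<open>Terms, the standard tree interpretation, regular sets\<close>

datatype (letters: 'a) kd_term =
    Letter 'a
  | Zero
  | One
  | Plus "'a kd_term" "'a kd_term"
  | Comp "'a kd_term" "'a kd_term"
  | Star "'a kd_term"
  | Dom "'a kd_term"

primrec tree_interp :: "'a kd_term \<Rightarrow> 'a ltree set"  ("\<lbrakk>_\<rbrakk>") where
  "\<lbrakk>Letter a\<rbrakk> = {tree_letter a}"
| "\<lbrakk>Zero\<rbrakk> = {}"
| "\<lbrakk>One\<rbrakk> = {tree_one}"
| "\<lbrakk>Plus s t\<rbrakk> = lang_plus \<lbrakk>s\<rbrakk> \<lbrakk>t\<rbrakk>"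
| "\<lbrakk>Comp s t\<rbrakk> = lang_comp \<lbrakk>s\<rbrakk> \<lbrakk>t\<rbrakk>"
| "\<lbrakk>Star t\<rbrakk> = lang_star \<lbrakk>t\<rbrakk>"
| "\<lbrakk>Dom t\<rbrakk> = lang_dom \<lbrakk>t\<rbrakk>"

definition regular :: "'a set \<Rightarrow> 'a ltree set \<Rightarrow> bool" where
  "regular \<Sigma> L \<longleftrightarrow> (\<exists>t. letters t \<subseteq> \<Sigma> \<and> L = \<lbrakk>t\<rbrakk>)"


section \<open>Algebras of the signature\<close>

record 'b kd_structure =
  univ :: "'b set"
  comp_op :: "'b \<Rightarrow> 'b \<Rightarrow> 'b"
  plus_op :: "'b \<Rightarrow> 'b \<Rightarrow> 'b"
  star_op :: "'b \<Rightarrow> 'b"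
  zero_op :: "'b"
  one_op :: "'b"
  dom_op :: "'b \<Rightarrow> 'b"

definition kd_algebra :: "'b kd_structure \<Rightarrow> bool" where
  "kd_algebra A \<longleftrightarrow>
     zero_op A \<in> univ A \<and>
     one_op A \<in> univ A \<and>
     (\<forall>x \<in> univ A. \<forall>y \<in> univ A. comp_op A x y \<in> univ A) \<and>
     (\<forall>x \<in> univ A. \<forall>y \<in> univ A. plus_op A x y \<in> univ A) \<and>
     (\<forall>x \<in> univ A. star_op A x \<in> univ A) \<and>
     (\<forall>x \<in> univ A. dom_op A x \<in> univ A)"

definition kd_hom :: "'b kd_structure \<Rightarrow> 'c kd_structure \<Rightarrow> ('b \<Rightarrow> 'c) set" where
  "kd_hom A B = {h \<in> univ A \<rightarrow>\<^sub>E univ B.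
     h (zero_op A) = zero_op B \<and>
     h (one_op A) = one_op B \<and>
     (\<forall>x \<in> univ A. \<forall>y \<in> univ A. h (comp_op A x y) = comp_op B (h x) (h y)) \<and>
     (\<forall>x \<in> univ A. \<forall>y \<in> univ A. h (plus_op A x y) = plus_op B (h x) (h y)) \<and>
     (\<forall>x \<in> univ A. h (star_op A x) = star_op B (h x)) \<and>
     (\<forall>x \<in> univ A. h (dom_op A x) = dom_op B (h x))}"

definition kd_isomorphic :: "'b kd_structure \<Rightarrow> 'c kd_structure \<Rightarrow> bool" where
  "kd_isomorphic A B \<longleftrightarrow> (\<exists>h \<in> kd_hom A B. bij_betw h (univ A) (univ B))"

definition rel_structure :: "'c set \<Rightarrow> 'c rel set \<Rightarrow> 'c rel kd_structure" where
  "rel_structure X U =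
     \<lparr> univ = U,
       comp_op = (\<lambda>R S. R O S),
       plus_op = (\<lambda>R S. R \<union> S),
       star_op = (\<lambda>R. Id_on X \<union> R\<^sup>+),
       zero_op = {},
       one_op = Id_on X,
       dom_op = (\<lambda>R. {(x, x) | x. \<exists>y. (x, y) \<in> R}) \<rparr>"

text \<open>
  The type argument is the type from which the base sets of the representing algebras of
  relations are drawn; HOL cannot quantify over it inside the definition.
\<close>

definition Rel :: "'c itself \<Rightarrow> 'b kd_structure set" where
  "Rel (_ :: 'c itself) =
     {A. kd_algebra A \<and>
         (\<exists>(X :: 'c set) U. U \<subseteq> Pow (X \<times> X) \<and> kd_algebra (rel_structure X U) \<and>
            kd_isomorphic A (rel_structure X U))}"

text \<open>Universal mapping property of F with generators \<open>\<eta> a\<close> (a in \<open>\<Sigma>\<close>) with respect to A.\<close>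

definition extends_uniquely ::
  "'b kd_structure \<Rightarrow> 'a set \<Rightarrow> ('a \<Rightarrow> 'b) \<Rightarrow> 'c kd_structure \<Rightarrow> bool" where
  "extends_uniquely F \<Sigma> \<eta> A \<longleftrightarrow>
     (\<forall>f \<in> \<Sigma> \<rightarrow> univ A. \<exists>!h. h \<in> kd_hom F A \<and> (\<forall>a \<in> \<Sigma>. h (\<eta> a) = f a))"

definition regular_tree_algebra :: "'a set \<Rightarrow> 'a ltree set kd_structure" where
  "regular_tree_algebra \<Sigma> =
     \<lparr> univ = {L. L \<subseteq> \<R> \<Sigma> \<and> regular \<Sigma> L},
       comp_op = lang_comp,
       plus_op = lang_plus,
       star_op = lang_star,
       zero_op = {},
       one_op = {tree_one},
       dom_op = lang_dom \<rparr>"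

end

theory Submission
  imports Defs
begin

text \<open>
  A pointed tree \<open>T\<close> denotes, in a graph \<open>\<rho>\<close> of relations, the pairs \<open>(x, y)\<close> such that \<open>T\<close> maps
  homomorphically to \<open>\<rho>\<close> with root at \<open>x\<close> and point at \<open>y\<close>. This denotation is monotone in the
  tree order, so it survives reduction and passing to maximal elements (only finitely many reduced
  trees lie above a given one), and the union of the denotations of the trees in \<open>\<lbrakk>t\<rbrakk>\<close> is the value
  of the term \<open>t\<close>. Hence \<open>\<lbrakk>t\<rbrakk>\<close> determines the value of \<open>t\<close> under every interpretation, which gives
  the universal property. Conversely, in the graph whose vertices are all trees and whose edges
  lead from a tree to its child subtrees, the denotation of \<open>S\<close> contains the pair of \<open>T\<close> and the
  subtree of \<open>T\<close> at its point iff \<open>T \<preceq> S\<close>. As antichains of reduced trees are determined by what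
  lies below them, this one graph represents the algebra of regular sets faithfully.
\<close>

section \<open>The homomorphism order and reduction\<close>

text \<open>The generated induction rule reaches subtrees through the set functions of
  \<open>fset\<close> and of pairs; here its hypothesis is rephrased for edges
  \<open>(a, T)\<close>.\<close>

lemma ltree_induct [case_names Node]:
  assumes "\<And>b C. (\<And>a T. (a, T) |\<in>| C \<Longrightarrow> P T) \<Longrightarrow> P (Node b C)"
  shows "P T"
proof (induction T)
  case (Node b C)
  show ?case
    by (rule assms) (metis Node snds.intros snd_conv)
qed

lemma points_Nil_iff [simp]: "[] \<in> points T \<longleftrightarrow> mark T"
  by (simp add: points_def vertices_def)

lemma points_Cons_iff [simp]:
  "e # p \<in> points T \<longleftrightarrow> e |\<in>| children T \<and> p \<in> points (snd e)"
  by (auto simp: points_def vertices_def)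

text \<open>The only edges out of a path \<open>q\<close> lead to one-step extensions of
  \<open>q\<close>, so preserving edges forces the image path to grow by one step with the same
  label.\<close>

lemma tree_hom_snoc:
  assumes "tree_hom f S T" "is_vertex S (p @ [(a, U)])"
  shows "\<exists>V. f (p @ [(a, U)]) = f p @ [(a, V)]"
proof -
  have "(p, a, p @ [(a, U)]) \<in> edges S"
    using assms(2) by (auto simp: edges_def vertices_def)
  then have "(f p, a, f (p @ [(a, U)])) \<in> edges T"
    using assms(1) by (fastforce simp: tree_hom_def)
  then show ?thesis by (auto simp: edges_def)
qed

lemma is_vertex_append [simp]:
  "is_vertex T (p @ q) \<longleftrightarrow> is_vertex T p \<and> is_vertex (subtree_at T p) q"
  by (induction p arbitrary: T) auto

lemma tree_homI:
  assumes "f [] = []"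
    and "\<And>p. p \<in> vertices S \<Longrightarrow> f p \<in> vertices T"
    and "\<And>p. p \<in> points S \<Longrightarrow> f p \<in> points T"
    and "\<And>p a U. is_vertex S (p @ [(a, U)]) \<Longrightarrow> \<exists>V. f (p @ [(a, U)]) = f p @ [(a, V)]"
  shows "tree_hom f S T"
proof -
  have "(f p, a, f q) \<in> edges T" if e: "(p, a, q) \<in> edges S" for p a q
  proof -
    obtain U where q: "q = p @ [(a, U)]" and v: "q \<in> vertices S"
      using e by (auto simp: edges_def)
    then obtain V where "f q = f p @ [(a, V)]"
      using assms(4)[of p a U] by (auto simp: vertices_def)
    moreover have "f q \<in> vertices T" using v assms(2) by blast
    ultimately show ?thesis by (auto simp: edges_def)
  qed
  then show ?thesis using assms(1-3) by (auto simp: tree_hom_def)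
qed

text \<open>The root is fixed, so the child \<open>S'\<close> goes to some child \<open>T'\<close>.
  Every path through \<open>S'\<close> then goes through \<open>T'\<close>, and stripping the first
  edge leaves a homomorphism from \<open>S'\<close> to \<open>T'\<close>.\<close>

lemma tree_hom_child:
  assumes f: "tree_hom f S T" and S': "(a, S') |\<in>| children S"
  shows "\<exists>T'. (a, T') |\<in>| children T \<and> T' \<preceq> S'"
proof -
  have vert: "f p \<in> vertices T" if "p \<in> vertices S" for p
    using f that by (auto simp: tree_hom_def)
  have pts: "f p \<in> points T" if "p \<in> points S" for p
    using f that by (auto simp: tree_hom_def)
  have nil: "f [] = []" using f by (simp add: tree_hom_def)
  obtain T' where T': "f [(a, S')] = [(a, T')]"
    using tree_hom_snoc[OF f, of "[]" a S'] S' nil by auto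
  \<comment> \<open>The induction runs from the end of the path, because
    \<open>tree_hom_snoc\<close> describes what happens when a last edge is appended.\<close>
  have pre: "\<exists>q. f ((a, S') # p) = (a, T') # q" if "is_vertex S' p" for p
    using that
  proof (induction p rule: rev_induct)
    case Nil
    then show ?case using T' by simp
  next
    case (snoc e p)
    obtain b U where e: "e = (b, U)" by fastforce
    obtain V where "f (((a, S') # p) @ [e]) = f ((a, S') # p) @ [(b, V)]"
      using tree_hom_snoc[OF f, of "(a, S') # p" b U] snoc.prems S' e by auto
    then show ?case using snoc by auto
  qed
  have "tree_hom (\<lambda>p. tl (f ((a, S') # p))) S' T'"
  proof (rule tree_homI)
    show "tl (f [(a, S')]) = []" using T' by simp
  next
    fix p assume p: "p \<in> vertices S'"
    then obtain q where "f ((a, S') # p) = (a, T') # q" using pre by (auto simp: vertices_def)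
    moreover have "f ((a, S') # p) \<in> vertices T" using p S' vert by (simp add: vertices_def)
    ultimately show "tl (f ((a, S') # p)) \<in> vertices T'" by (simp add: vertices_def)
  next
    fix p assume p: "p \<in> points S'"
    then obtain q where "f ((a, S') # p) = (a, T') # q"
      using pre by (auto simp: points_def vertices_def)
    moreover have "f ((a, S') # p) \<in> points T" using p S' pts by simp
    ultimately show "tl (f ((a, S') # p)) \<in> points T'" by simp
  next
    fix p b U assume v: "is_vertex S' (p @ [(b, U)])"
    then obtain q where "f ((a, S') # p) = (a, T') # q" using pre by auto
    moreover obtain V where "f (((a, S') # p) @ [(b, U)]) = f ((a, S') # p) @ [(b, V)]"
      using tree_hom_snoc[OF f, of "(a, S') # p" b U] v S' by auto
    ultimately show "\<exists>V. tl (f ((a, S') # p @ [(b, U)])) = tl (f ((a, S') # p)) @ [(b, V)]"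
      by simp
  qed
  then have "T' \<preceq> S'" by (auto simp: tree_le_def)
  moreover have "(a, T') |\<in>| children T"
    using vert[of "[(a, S')]"] S' T' by (simp add: vertices_def)
  ultimately show ?thesis by blast
qed

text \<open>This turns the order into a recursion on trees, so that most later arguments need no
  maps on paths. For the converse direction, homomorphisms chosen for the individual children are
  joined at the root.\<close>

lemma tree_le_iff:
  "T \<preceq> S \<longleftrightarrow> (mark S \<longrightarrow> mark T) \<and>
     (\<forall>a S'. (a, S') |\<in>| children S \<longrightarrow> (\<exists>T'. (a, T') |\<in>| children T \<and> T' \<preceq> S'))"
  (is "_ \<longleftrightarrow> ?m \<and> ?c")
proof
  assume "T \<preceq> S"
  then obtain f where f: "tree_hom f S T" by (auto simp: tree_le_def)
  have ?m
  proof
    assume "mark S"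
    then have "f [] \<in> points T" using f points_Nil_iff[of S] unfolding tree_hom_def by blast
    then show "mark T" using f by (simp add: tree_hom_def)
  qed
  moreover have ?c using tree_hom_child[OF f] by blast
  ultimately show "?m \<and> ?c" by blast
next
  assume r: "?m \<and> ?c"
  have "\<forall>e. \<exists>g. e |\<in>| children S \<longrightarrow>
      (\<exists>T'. (fst e, T') |\<in>| children T \<and> tree_hom g (snd e) T')"
    using r by (force simp: tree_le_def)
  then obtain g where g: "\<And>e. e |\<in>| children S \<Longrightarrow>
      \<exists>T'. (fst e, T') |\<in>| children T \<and> tree_hom (g e) (snd e) T'"
    by metis
  then obtain h where h: "\<And>e. e |\<in>| children S \<Longrightarrow>
      (fst e, h e) |\<in>| children T \<and> tree_hom (g e) (snd e) (h e)"
    by metis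
  \<comment> \<open>\<open>h e\<close> is the child chosen as target of the edge \<open>e\<close>,
    and \<open>g e\<close> maps the subtree under \<open>e\<close> into it: \<open>f\<close>
    redirects the first edge of a path and passes the rest to \<open>g e\<close>.\<close>
  define f where "f p = (case p of [] \<Rightarrow> [] | e # q \<Rightarrow> (fst e, h e) # g e q)" for p
  have "tree_hom f S T"
  proof (rule tree_homI)
    show "f [] = []" by (simp add: f_def)
  next
    fix p assume p: "p \<in> vertices S"
    show "f p \<in> vertices T"
    proof (cases p)
      case (Cons e q)
      then have e: "e |\<in>| children S" "q \<in> vertices (snd e)" using p by (auto simp: vertices_def)
      then have "g e q \<in> vertices (h e)" using h[of e] by (auto simp: tree_hom_def)
      then show ?thesis using Cons e h[of e] by (simp add: f_def vertices_def)
    qed (simp add: f_def vertices_def)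
  next
    fix p assume p: "p \<in> points S"
    show "f p \<in> points T"
    proof (cases p)
      case (Cons e q)
      then have e: "e |\<in>| children S" "q \<in> points (snd e)" using p by auto
      then have "g e q \<in> points (h e)" using h[of e] by (auto simp: tree_hom_def)
      then show ?thesis using Cons e h[of e] by (simp add: f_def)
    qed (use p r in \<open>simp add: f_def\<close>)
  next
    fix p a U assume v: "is_vertex S (p @ [(a, U)])"
    show "\<exists>V. f (p @ [(a, U)]) = f p @ [(a, V)]"
    proof (cases p)
      case Nil
      have "g (a, U) [] = []" using h[of "(a, U)"] v Nil by (auto simp: tree_hom_def)
      then show ?thesis using Nil by (simp add: f_def)
    next
      case (Cons e q)
      then have "tree_hom (g e) (snd e) (h e)" "is_vertex (snd e) (q @ [(a, U)])"
        using v h[of e] by auto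
      then show ?thesis using tree_hom_snoc[of "g e" "snd e" "h e" q a U] Cons
        by (simp add: f_def)
    qed
  qed
  then show "T \<preceq> S" by (auto simp: tree_le_def)
qed

lemma tree_le_refl [simp]: "T \<preceq> T"
  by (induction T rule: ltree_induct) (subst tree_le_iff, auto)

lemma tree_le_trans: "T \<preceq> S \<Longrightarrow> S \<preceq> U \<Longrightarrow> T \<preceq> U"
proof (induction U arbitrary: S T rule: ltree_induct)
  case (Node b C)
  show ?case
    using Node.prems tree_le_iff[of T S] tree_le_iff[of S "Node b C"]
      tree_le_iff[of T "Node b C"] Node.IH by (metis ltree.sel)
qed

section \<open>Reduced trees and antisymmetry of the order\<close>

lemma minimal_children_iff:
  "(a, T) |\<in>| minimal_children C \<longleftrightarrow>
     (a, T) |\<in>| C \<and> \<not> (\<exists>S. (a, S) |\<in>| C \<and> S \<preceq> T \<and> S \<noteq> T)"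
  by (auto simp: minimal_children_def)

lemma reduced_children:
  assumes "reduced T" "(a, S) |\<in>| children T" "(a, S') |\<in>| children T" "S' \<preceq> S"
  shows "S' = S"
proof (cases T)
  case (Node b C)
  then have "(a, S) |\<in>| minimal_children (fimage (map_prod id reduce) C)"
    "(a, S') |\<in>| minimal_children (fimage (map_prod id reduce) C)"
    using assms by (auto simp: reduced_def)
  then show ?thesis using assms(4) unfolding minimal_children_iff by blast
qed

lemma minimal_children_idem [simp]:
  "minimal_children (minimal_children C) = minimal_children C"
  by (rule fset_eqI) (auto simp: minimal_children_def)

text \<open>A second pass finds the surviving children already reduced, by induction, and already
  minimal.\<close>

lemma reduced_reduce: "reduced (reduce T)"
proof (induction T rule: ltree_induct)
  case (Node b C)
  let ?M = "minimal_children (fimage (map_prod id reduce) C)"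
  have "reduce S = S" if "(a, S) |\<in>| ?M" for a S
    using that Node by (auto simp: minimal_children_iff reduced_def)
  then have "fimage (map_prod id reduce) ?M = fimage id ?M"
    by (intro fimage_cong) auto
  then show ?case by (simp add: reduced_def)
qed

lemma reduced_child:
  assumes "reduced T" "(a, S) |\<in>| children T"
  shows "reduced S"
proof (cases T)
  case (Node b C)
  then have "(a, S) |\<in>| minimal_children (fimage (map_prod id reduce) C)"
    using assms by (auto simp: reduced_def)
  then show ?thesis by (auto simp: minimal_children_iff reduced_reduce)
qed

text \<open>Going from a child \<open>U\<close> of one tree to a child \<open>V\<close> below it in
  the other and back to \<open>U'\<close> below \<open>V\<close> gives \<open>U' = U\<close>, since
  equally labelled children of a reduced tree are incomparable. So \<open>U\<close> and
  \<open>V\<close> are equivalent, and equal by induction.\<close>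

lemma reduced_antisym:
  "reduced T \<Longrightarrow> reduced S \<Longrightarrow> T \<preceq> S \<Longrightarrow> S \<preceq> T \<Longrightarrow> T = S"
proof (induction T arbitrary: S rule: ltree_induct)
  case (Node b C)
  let ?T = "Node b C"
  \<comment> \<open>This is stated for arbitrary \<open>A\<close> and \<open>B\<close> because both
    inclusions between the child sets need it. The induction hypothesis has children of
    \<open>?T\<close> on its left only, so it enters as the premise \<open>IH\<close>, which the
    second use obtains by symmetry.\<close>
  have step: "(a, U) |\<in>| children B"
    if AB: "reduced A" "reduced B" "A \<preceq> B" "B \<preceq> A" and U: "(a, U) |\<in>| children A"
      and IH: "\<And>V. (a, V) |\<in>| children B \<Longrightarrow> U \<preceq> V \<Longrightarrow> V \<preceq> U \<Longrightarrow> U = V"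
    for A B :: "'a ltree" and a U
  proof -
    obtain V where V: "(a, V) |\<in>| children B" "V \<preceq> U"
      using AB U tree_le_iff[of B A] by blast
    obtain U' where U': "(a, U') |\<in>| children A" "U' \<preceq> V"
      using AB V tree_le_iff[of A B] by blast
    have "U' = U" using reduced_children[OF AB(1) U U'(1)] tree_le_trans U'(2) V(2) by blast
    then have "U = V" using IH V U' by blast
    then show ?thesis using V by blast
  qed
  have "(a, U) |\<in>| children S" if U: "(a, U) |\<in>| C" for a U
  proof (rule step[OF Node.prems])
    show "(a, U) |\<in>| children ?T" using U by simp
    fix V assume V: "(a, V) |\<in>| children S" and le: "U \<preceq> V" "V \<preceq> U"
    have "reduced U" using reduced_child[OF Node.prems(1), of a U] U by simp
    then show "U = V" by (rule Node.IH[OF U _ reduced_child[OF Node.prems(2) V] le])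
  qed
  moreover have "(a, U) |\<in>| C" if U: "(a, U) |\<in>| children S" for a U
  proof -
    have "(a, U) |\<in>| children ?T"
    proof (rule step[OF Node.prems(2,1,4,3) U])
      fix V assume V: "(a, V) |\<in>| children ?T" and le: "U \<preceq> V" "V \<preceq> U"
      have "V = U"
        by (rule Node.IH[OF _ reduced_child[OF Node.prems(1) V]
              reduced_child[OF Node.prems(2) U] le(2,1)]) (use V in simp)
      then show "U = V" ..
    qed
    then show ?thesis by simp
  qed
  ultimately have "children S = C" by auto
  moreover have "mark S = b"
    using iffD1[OF tree_le_iff Node.prems(3)] iffD1[OF tree_le_iff Node.prems(4)] by auto
  ultimately show ?case by (cases S) auto
qed

section \<open>Existence of minimal and maximal elements\<close>

lemma strict_tree_le_order:
  assumes "\<And>T. T \<in> K \<Longrightarrow> reduced T"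
  shows "asymp_on K (\<lambda>S U. S \<preceq> U \<and> S \<noteq> U)" "transp_on K (\<lambda>S U. S \<preceq> U \<and> S \<noteq> U)"
proof -
  show "asymp_on K (\<lambda>S U. S \<preceq> U \<and> S \<noteq> U)"
    by (rule asymp_onI) (use reduced_antisym assms in blast)
  show "transp_on K (\<lambda>S U. S \<preceq> U \<and> S \<noteq> U)"
  proof (rule transp_onI)
    fix S T U assume K: "S \<in> K" "T \<in> K" "U \<in> K" and "S \<preceq> T \<and> S \<noteq> T" "T \<preceq> U \<and> T \<noteq> U"
    then show "S \<preceq> U \<and> S \<noteq> U"
      using reduced_antisym[OF assms[OF K(1)] assms[OF K(2)]] tree_le_trans[of S T U] by blast
  qed
qed

text \<open>Minimality is sought only among the finitely many candidates below \<open>T\<close>; by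
  transitivity such an element is minimal in all of \<open>C\<close>.\<close>

lemma minimal_children_below:
  assumes red: "\<And>a T. (a, T) |\<in>| C \<Longrightarrow> reduced T" and T: "(a, T) |\<in>| C"
  shows "\<exists>S. (a, S) |\<in>| minimal_children C \<and> S \<preceq> T"
proof -
  define K where "K = {S. (a, S) |\<in>| C \<and> S \<preceq> T}"
  have "K \<subseteq> snd ` fset C" by (auto simp: K_def image_iff) (metis snd_conv)
  then have "finite K" by (rule finite_subset) simp
  moreover have "T \<in> K" using T by (simp add: K_def)
  moreover have "\<And>S. S \<in> K \<Longrightarrow> reduced S" using red by (auto simp: K_def)
  note strict_tree_le_order[of K, OF this]
  ultimately obtain S where S: "S \<in> K" "\<And>U. U \<in> K \<Longrightarrow> \<not> (U \<preceq> S \<and> U \<noteq> S)"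
    using Finite_Set.bex_min_element[of K "\<lambda>S U. S \<preceq> U \<and> S \<noteq> U"] by auto
  have "(a, S) |\<in>| minimal_children C"
    unfolding minimal_children_iff using S tree_le_trans by (auto simp: K_def)
  then show ?thesis using S by (auto simp: K_def)
qed

text \<open>A discarded child can be mapped to a kept child below it, and the kept children are
  reductions of original ones.\<close>

lemma reduce_equiv: "reduce T \<preceq> T" "T \<preceq> reduce T"
proof (induction T rule: ltree_induct)
  case (Node b C)
  let ?R = "fimage (map_prod id reduce) C"
  case 1
  show ?case
  proof (subst tree_le_iff, safe)
    fix a S assume "(a, S) |\<in>| children (Node b C)"
    then have S: "(a, S) |\<in>| C" by simp
    then have "(a, reduce S) |\<in>| ?R" by force
    then obtain U where "(a, U) |\<in>| minimal_children ?R" "U \<preceq> reduce S"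
      using minimal_children_below[of ?R a "reduce S"] reduced_reduce by auto
    then show "\<exists>T'. (a, T') |\<in>| children (reduce (Node b C)) \<and> T' \<preceq> S"
      using Node(1)[OF S] tree_le_trans by auto
  qed simp
  case 2
  show ?case
    by (subst tree_le_iff) (auto simp: minimal_children_iff intro: Node(2))
qed

text \<open>A reduced tree above \<open>Node b C\<close> is determined by its mark and its set of
  child edges. These edges lie in the set \<open>F\<close> of pairs of a label and a reduced tree
  above an equally labelled child in \<open>C\<close>, which is finite by induction.\<close>

lemma finite_reduced_above: "finite {S. reduced S \<and> T \<preceq> S}"
proof (induction T rule: ltree_induct)
  case (Node b C)
  define F where "F = (\<Union>(a, T) \<in> fset C. Pair a ` {S. reduced S \<and> T \<preceq> S})"
  have "finite F" using Node by (auto simp: F_def)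
  moreover have "fset (children S) \<subseteq> F" if S: "reduced S" "Node b C \<preceq> S" for S
  proof
    fix e assume e: "e \<in> fset (children S)"
    obtain a U where aU: "e = (a, U)" by (cases e)
    then obtain T where "(a, T) |\<in>| C" "T \<preceq> U"
      using e iffD1[OF tree_le_iff S(2)] by auto
    moreover have "reduced U" using reduced_child[OF S(1), of a U] e aU by simp
    ultimately show "e \<in> F" using aU by (auto simp: F_def)
  qed
  then have "(\<lambda>S. (mark S, fset (children S))) ` {S. reduced S \<and> Node b C \<preceq> S}
      \<subseteq> UNIV \<times> Pow F"
    by auto
  ultimately have "finite ((\<lambda>S. (mark S, fset (children S))) ` {S. reduced S \<and> Node b C \<preceq> S})"
    by (meson finite_Pow_iff finite_SigmaI finite_UNIV finite_subset)
  then show ?case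
    by (rule finite_imageD) (auto simp: inj_on_def fset_inject intro: ltree.expand)
qed

text \<open>\<open>K\<close> may be infinite, as it is for a star, but ascending from
  \<open>T\<close> stays inside the finite set of reduced trees above \<open>T\<close>.\<close>

lemma maximal_above:
  assumes red: "\<And>T. T \<in> K \<Longrightarrow> reduced T" and T: "T \<in> K"
  shows "\<exists>S \<in> maximal K. T \<preceq> S"
proof -
  define M where "M = {S \<in> K. T \<preceq> S}"
  have "finite M"
    by (rule finite_subset[OF _ finite_reduced_above[of T]]) (use red in \<open>auto simp: M_def\<close>)
  moreover have "T \<in> M" using T by (simp add: M_def)
  moreover have "\<And>S. S \<in> M \<Longrightarrow> reduced S" using red by (auto simp: M_def)
  note strict_tree_le_order[of M, OF this]
  ultimately obtain S where S: "S \<in> M" "\<And>U. U \<in> M \<Longrightarrow> \<not> (S \<preceq> U \<and> S \<noteq> U)"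
    using Finite_Set.bex_max_element[of M "\<lambda>S U. S \<preceq> U \<and> S \<noteq> U"] by fastforce
  have "S \<in> maximal K" using S tree_le_trans by (auto simp: maximal_def M_def)
  then show ?thesis using S by (auto simp: M_def)
qed


section \<open>Closure of the reduced pointed trees under the operations\<close>

lemma points_empty_iff:
  "points (Node b C) = {} \<longleftrightarrow> \<not> b \<and> (\<forall>e. e |\<in>| C \<longrightarrow> points (snd e) = {})"
proof -
  have "points (Node b C) = {} \<longleftrightarrow> (\<forall>p. p \<notin> points (Node b C))" by blast
  also have "\<dots> \<longleftrightarrow> [] \<notin> points (Node b C) \<and> (\<forall>e p. e # p \<notin> points (Node b C))"
    by (metis neq_Nil_conv)
  finally show ?thesis by auto
qed

lemma pointed_Node_True:
  "pointed (Node True C) \<longleftrightarrow> (\<forall>e. e |\<in>| C \<longrightarrow> points (snd e) = {})"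
proof
  assume "pointed (Node True C)"
  then have "p = []" if "p \<in> points (Node True C)" for p
    using that points_Nil_iff[of "Node True C"] unfolding pointed_def by (metis ltree.sel(1))
  then show "\<forall>e. e |\<in>| C \<longrightarrow> points (snd e) = {}"
    using points_Cons_iff[of _ _ "Node True C"] by fastforce
next
  assume r: "\<forall>e. e |\<in>| C \<longrightarrow> points (snd e) = {}"
  have "p = []" if "p \<in> points (Node True C)" for p
    using that r by (cases p) auto
  then show "pointed (Node True C)" unfolding pointed_def by (intro ex1I[of _ "[]"]) auto
qed

text \<open>Together with \<open>pointed_Node_True\<close> this makes pointedness recursive: below
  an unmarked root, exactly one child edge leads to the point.\<close>

lemma pointed_Node_False:
  "pointed (Node False C) \<longleftrightarrow>
     (\<exists>e. e |\<in>| C \<and> pointed (snd e) \<and> (\<forall>e'. e' |\<in>| C \<longrightarrow> e' \<noteq> e \<longrightarrow> points (snd e') = {}))"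
proof
  assume "pointed (Node False C)"
  then obtain p where p: "p \<in> points (Node False C)"
    and u: "\<And>q. q \<in> points (Node False C) \<Longrightarrow> q = p"
    unfolding pointed_def by blast
  obtain e q where e: "p = e # q" "e |\<in>| C" "q \<in> points (snd e)" using p by (cases p) auto
  have u': "e' = e \<and> q' = q" if "e' |\<in>| C" "q' \<in> points (snd e')" for e' q'
    using u[of "e' # q'"] that e by auto
  show "\<exists>e. e |\<in>| C \<and> pointed (snd e) \<and>
      (\<forall>e'. e' |\<in>| C \<longrightarrow> e' \<noteq> e \<longrightarrow> points (snd e') = {})"
  proof (intro exI conjI allI impI)
    show "pointed (snd e)" unfolding pointed_def using e u' by blast
  qed (use e u' in blast)+
next
  assume "\<exists>e. e |\<in>| C \<and> pointed (snd e) \<and>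
      (\<forall>e'. e' |\<in>| C \<longrightarrow> e' \<noteq> e \<longrightarrow> points (snd e') = {})"
  then obtain e where e: "e |\<in>| C" "pointed (snd e)"
    "\<And>e'. e' |\<in>| C \<Longrightarrow> e' \<noteq> e \<Longrightarrow> points (snd e') = {}" by blast
  from e(2) obtain q where q: "q \<in> points (snd e)" "\<And>q'. q' \<in> points (snd e) \<Longrightarrow> q' = q"
    unfolding pointed_def by blast
  show "pointed (Node False C)" unfolding pointed_def
  proof (rule ex1I)
    show "e # q \<in> points (Node False C)" using e(1) q(1) by simp
    fix p assume "p \<in> points (Node False C)"
    then obtain e' q' where "p = e' # q'" "e' |\<in>| C" "q' \<in> points (snd e')"
      by (cases p) auto
    then show "p = e # q" using e(3)[of e'] q by blast
  qed
qed

section \<open>Pointedness under reduction, gluing and unmarking\<close>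

lemma pointed_imp_points: "pointed T \<Longrightarrow> points T \<noteq> {}"
  by (auto simp: pointed_def)

lemma points_empty_mono: "T \<preceq> S \<Longrightarrow> points T = {} \<Longrightarrow> points S = {}"
  by (auto simp: tree_le_def tree_hom_def)

lemma points_reduce_empty: "points T = {} \<Longrightarrow> points (reduce T) = {}"
  using points_empty_mono reduce_equiv(2) by blast

text \<open>The danger is that reduction discards the branch with the point. It cannot: a tree below
  a pointed tree has a marked vertex, and no sibling of that branch has one.\<close>

lemma pointed_reduce: "pointed T \<Longrightarrow> pointed (reduce T)"
proof (induction T rule: ltree_induct)
  case (Node b C)
  let ?R = "fimage (map_prod id reduce) C"
  show ?case
  proof (cases b)
    case True
    then show ?thesis using Node.prems
      by (auto simp: pointed_Node_True minimal_children_iff intro!: points_reduce_empty)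
  next
    case False
    then obtain a T where T: "(a, T) |\<in>| C" "pointed T"
      and u: "\<And>e'. e' |\<in>| C \<Longrightarrow> e' \<noteq> (a, T) \<Longrightarrow> points (snd e') = {}"
      using Node.prems by (auto simp: pointed_Node_False)
    have p: "pointed (reduce T)" using Node.IH T by blast
    have others: "points S = {}" if "(c, S) |\<in>| ?R" "(c, S) \<noteq> (a, reduce T)" for c S
      using that u points_reduce_empty by fastforce
    have "(a, reduce T) |\<in>| ?R" using T by force
    moreover have "S = reduce T" if "(a, S) |\<in>| ?R" "S \<preceq> reduce T" for S
      using others[of a S] that p points_empty_mono pointed_imp_points by blast
    ultimately have "(a, reduce T) |\<in>| minimal_children ?R"
      unfolding minimal_children_iff by blast
    moreover have "points (snd e) = {}" if "e |\<in>| minimal_children ?R" "e \<noteq> (a, reduce T)" for e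
      using others[of "fst e" "snd e"] that
      by (metis prod.collapse minimal_children_iff)
    ultimately have "pointed (Node False (minimal_children ?R))"
      using p unfolding pointed_Node_False by (metis snd_conv)
    then show ?thesis using False by simp
  qed
qed

text \<open>Gluing changes only the branch that leads to the point; this lemma disposes of all the
  others.\<close>

lemma glue_unmarked: "points T = {} \<Longrightarrow> glue S T = T"
proof (induction T rule: ltree_induct)
  case (Node b C)
  then have "fimage (map_prod id (glue S)) C = fimage id C"
    by (intro fimage_cong) (auto simp: points_empty_iff)
  then show ?case using Node.prems by (simp add: points_empty_iff)
qed

lemma glue_Node_True:
  assumes "pointed (Node True C)"
  shows "glue S (Node True C) = Node (mark S) (C |\<union>| children S)"
proof -
  have "fimage (map_prod id (glue S)) C = fimage id C"
    using assms by (intro fimage_cong) (auto simp: pointed_Node_True glue_unmarked)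
  then show ?thesis by simp
qed

lemma pointed_glue: "pointed T \<Longrightarrow> pointed S \<Longrightarrow> pointed (glue S T)"
proof (induction T rule: ltree_induct)
  case (Node b C)
  show ?case
  proof (cases b)
    case True
    then have C: "\<And>e. e |\<in>| C \<Longrightarrow> points (snd e) = {}"
      using Node.prems(1) by (metis (full_types) pointed_Node_True)
    have "pointed (Node (mark S) (C |\<union>| children S))"
    proof (cases S)
      case S: (Node m E)
      show ?thesis
      proof (cases m)
        case True
        then show ?thesis using S C Node.prems by (auto simp: pointed_Node_True)
      next
        case False
        then have "pointed (Node False E)" using S Node.prems(2) by simp
        then have "pointed (Node False (C |\<union>| E))"
          unfolding pointed_Node_False using C by (metis funion_iff pointed_imp_points)
        then show ?thesis using S False by simp
      qed
    qed
    then show ?thesis using glue_Node_True[of C S] True Node.prems by simp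
  next
    case False
    then obtain a T where T: "(a, T) |\<in>| C" "pointed T"
      and u: "\<And>e'. e' |\<in>| C \<Longrightarrow> e' \<noteq> (a, T) \<Longrightarrow> points (snd e') = {}"
      using Node.prems by (auto simp: pointed_Node_False)
    have "pointed (glue S T)" using Node T by blast
    moreover have "(a, glue S T) |\<in>| fimage (map_prod id (glue S)) C" using T by force
    moreover have "points (snd e) = {}"
      if e: "e |\<in>| fimage (map_prod id (glue S)) C" "e \<noteq> (a, glue S T)" for e
    proof -
      obtain c U where U: "(c, U) |\<in>| C" "e = (c, glue S U)" using e(1) by auto
      then have "points U = {}" using u[of "(c, U)"] e by auto
      then show ?thesis using U by (simp add: glue_unmarked)
    qed
    ultimately have "pointed (Node False (fimage (map_prod id (glue S)) C))"
      unfolding pointed_Node_False by (metis snd_conv)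
    then show ?thesis using False by simp
  qed
qed

lemma points_unmark: "points (unmark T) = {}"
  by (induction T rule: ltree_induct) (auto simp: points_empty_iff)

section \<open>Labels under the operations\<close>

lemma labels_Node: "labels (Node b C) = (\<Union>(a, T) \<in> fset C. insert a (labels T))"
  by (force elim: fsts.cases snds.cases simp: fsts.simps snds.simps)

lemma labels_children: "labels T = (\<Union>(a, S) \<in> fset (children T). insert a (labels S))"
  by (cases T) (simp add: labels_Node del: ltree.set)

lemma labels_iff: "x \<in> labels T \<longleftrightarrow> (\<exists>a S. (a, S) |\<in>| children T \<and> (x = a \<or> x \<in> labels S))"
  by (subst labels_children) auto

lemma labels_reduce: "labels (reduce T) \<subseteq> labels T"
proof (induction T rule: ltree_induct)
  case (Node b C)
  show ?case
  proof
    fix x assume "x \<in> labels (reduce (Node b C))"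
    then obtain a U where U: "(a, U) |\<in>| children (reduce (Node b C))" "x = a \<or> x \<in> labels U"
      using labels_iff[of x "reduce (Node b C)"] by blast
    then obtain V where V: "(a, V) |\<in>| C" "U = reduce V"
      by (auto simp: minimal_children_iff)
    then have "x = a \<or> x \<in> labels V" using U(2) Node.IH by blast
    then show "x \<in> labels (Node b C)" using V(1) labels_iff[of x "Node b C"] by auto
  qed
qed

lemma labels_glue: "labels (glue S T) \<subseteq> labels S \<union> labels T"
proof (induction T rule: ltree_induct)
  case (Node b C)
  show ?case
  proof
    fix x assume "x \<in> labels (glue S (Node b C))"
    then obtain a U where U: "(a, U) |\<in>| children (glue S (Node b C))" "x = a \<or> x \<in> labels U"
      using labels_iff[of x "glue S (Node b C)"] by blast
    then consider V where "(a, V) |\<in>| C" "U = glue S V" | "(a, U) |\<in>| children S"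
      by (cases b) (auto simp: Let_def)
    then show "x \<in> labels S \<union> labels (Node b C)"
    proof cases
      case 1
      then have "x = a \<or> x \<in> labels S \<or> x \<in> labels V" using U(2) Node.IH by blast
      then show ?thesis using 1(1) labels_iff[of x "Node b C"] by auto
    next
      case 2
      then show ?thesis using U(2) labels_iff[of x S] by blast
    qed
  qed
qed

lemma labels_unmark: "labels (unmark T) \<subseteq> labels T"
proof (induction T rule: ltree_induct)
  case (Node b C)
  show ?case
  proof
    fix x assume "x \<in> labels (unmark (Node b C))"
    then obtain a U where U: "(a, U) |\<in>| children (unmark (Node b C))" "x = a \<or> x \<in> labels U"
      using labels_iff[of x "unmark (Node b C)"] by blast
    then obtain V where V: "(a, V) |\<in>| C" "U = unmark V"
      by auto
    then have "x = a \<or> x \<in> labels V" using U(2) Node.IH by blast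
    then show "x \<in> labels (Node b C)" using V(1) labels_iff[of x "Node b C"] by auto
  qed
qed

lemma tree_comp_in_R: "T \<in> \<R> \<Sigma> \<Longrightarrow> S \<in> \<R> \<Sigma> \<Longrightarrow> tree_comp T S \<in> \<R> \<Sigma>"
  unfolding reduced_ptrees_def tree_comp_def
  using labels_reduce[of "glue S T"] labels_glue[of S T]
  by (simp add: reduced_reduce pointed_reduce pointed_glue) blast

lemma tree_dom_in_R:
  assumes "T \<in> \<R> \<Sigma>" shows "tree_dom T \<in> \<R> \<Sigma>"
proof -
  let ?U = "Node True (children (unmark T))"
  \<comment> \<open>The tree is \<open>unmark T\<close> itself, written with an explicit root so
    that \<open>points_empty_iff\<close> applies to its children.\<close>
  have "points (Node (mark (unmark T)) (children (unmark T))) = {}"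
    using points_unmark[of T] by simp
  then have "pointed ?U" unfolding points_empty_iff pointed_Node_True by blast
  moreover have "labels ?U = labels (unmark T)"
    unfolding labels_children[of "unmark T"] labels_Node ..
  moreover have "labels T \<subseteq> \<Sigma>" using assms by (simp add: reduced_ptrees_def)
  ultimately have "labels (tree_dom T) \<subseteq> \<Sigma>"
    unfolding tree_dom_def using labels_reduce[of ?U] labels_unmark[of T] by order
  moreover have "pointed (tree_dom T)" "reduced (tree_dom T)"
    unfolding tree_dom_def by (rule pointed_reduce[OF \<open>pointed ?U\<close>], rule reduced_reduce)
  ultimately show ?thesis by (simp add: reduced_ptrees_def)
qed

lemma minimal_children_empty [simp]: "minimal_children {||} = {||}"
  by (rule fset_eqI) (auto simp: minimal_children_def)

lemma minimal_children_singleton [simp]: "minimal_children {|e|} = {|e|}"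
  by (cases e, rule fset_eqI) (auto simp: minimal_children_def)

lemma tree_one_in_R: "tree_one \<in> \<R> \<Sigma>"
  by (simp add: reduced_ptrees_def tree_one_def pointed_Node_True reduced_def)

lemma tree_letter_in_R:
  assumes "a \<in> \<Sigma>" shows "tree_letter a \<in> \<R> \<Sigma>"
proof -
  have "pointed (Node True {||})" by (simp add: pointed_Node_True)
  then have "pointed (tree_letter a)" by (simp add: tree_letter_def pointed_Node_False)
  moreover have "labels (tree_letter a) = {a}"
    by (simp add: tree_letter_def labels_Node del: ltree.set)
  moreover have "reduced (tree_letter a)" by (simp add: tree_letter_def reduced_def)
  ultimately show ?thesis using assms by (simp add: reduced_ptrees_def)
qed

section \<open>Sets of reduced pointed trees\<close>

lemma maximal_subset: "maximal K \<subseteq> K"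
  by (auto simp: maximal_def)

lemma set_comp_subset_R: "L \<subseteq> \<R> \<Sigma> \<Longrightarrow> M \<subseteq> \<R> \<Sigma> \<Longrightarrow> set_comp L M \<subseteq> \<R> \<Sigma>"
  using tree_comp_in_R unfolding set_comp_def by blast

lemma set_power_subset_R: "L \<subseteq> \<R> \<Sigma> \<Longrightarrow> set_power L i \<subseteq> \<R> \<Sigma>"
  by (induction i) (simp_all add: tree_one_in_R set_comp_subset_R)

lemma tree_interp_subset_R: "letters t \<subseteq> \<Sigma> \<Longrightarrow> \<lbrakk>t\<rbrakk> \<subseteq> \<R> \<Sigma>"
proof (induction t)
  case (Letter a)
  then show ?case by (simp add: tree_letter_in_R)
next
  case (Plus s t)
  then have "\<lbrakk>s\<rbrakk> \<union> \<lbrakk>t\<rbrakk> \<subseteq> \<R> \<Sigma>" by simp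
  then show ?case unfolding tree_interp.simps lang_plus_def using maximal_subset by blast
next
  case (Comp s t)
  then have "set_comp \<lbrakk>s\<rbrakk> \<lbrakk>t\<rbrakk> \<subseteq> \<R> \<Sigma>" by (simp add: set_comp_subset_R)
  then show ?case unfolding tree_interp.simps lang_comp_def using maximal_subset by blast
next
  case (Star t)
  then have "(\<Union>i. set_power \<lbrakk>t\<rbrakk> i) \<subseteq> \<R> \<Sigma>" using set_power_subset_R[of "\<lbrakk>t\<rbrakk>" \<Sigma>] by auto
  then show ?case unfolding tree_interp.simps lang_star_def using maximal_subset by blast
next
  case (Dom t)
  then have "tree_dom ` \<lbrakk>t\<rbrakk> \<subseteq> \<R> \<Sigma>" using tree_dom_in_R by auto
  then show ?case unfolding tree_interp.simps lang_dom_def using maximal_subset by blast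
qed (simp_all add: tree_one_in_R)

lemma maximal_maximal: "maximal (maximal K) = maximal K"
  unfolding maximal_def by blast

text \<open>Empty sets and singletons are antichains, and every compound term ends in an application
  of \<open>maximal\<close>. Representability needs this to recover a regular set from its
  denotation.\<close>

lemma maximal_tree_interp: "maximal \<lbrakk>t\<rbrakk> = \<lbrakk>t\<rbrakk>"
  by (cases t) (simp_all add: lang_plus_def lang_comp_def lang_star_def lang_dom_def
      maximal_maximal, auto simp: maximal_def)


section \<open>Relational semantics of trees\<close>

text \<open>
  \<open>sat \<rho> T x y\<close> says that \<open>T\<close> maps homomorphically to the graph \<open>\<rho>\<close> with the root sent to \<open>x\<close>
  and every marked vertex to \<open>y\<close>.
\<close>

primrec sat :: "('a \<Rightarrow> 'c rel) \<Rightarrow> 'a ltree \<Rightarrow> 'c \<Rightarrow> 'c \<Rightarrow> bool" where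
  "sat \<rho> (Node b C) = (\<lambda>x y. (b \<longrightarrow> x = y) \<and>
     fBall (fimage (map_prod id (sat \<rho>)) C) (\<lambda>(a, P). \<exists>x'. (x, x') \<in> \<rho> a \<and> P x' y))"

text \<open>The image under \<open>sat \<rho>\<close> in the definition is there for primitive
  recursion through \<open>fset\<close> and pairs; this equation and \<open>sat_Node\<close> replace
  it from here on.\<close>

lemma sat_iff:
  "sat \<rho> T x y \<longleftrightarrow> (mark T \<longrightarrow> x = y) \<and>
     (\<forall>a S. (a, S) |\<in>| children T \<longrightarrow> (\<exists>x'. (x, x') \<in> \<rho> a \<and> sat \<rho> S x' y))"
  by (cases T) fastforce

lemma sat_Node:
  "sat \<rho> (Node b C) x y \<longleftrightarrow> (b \<longrightarrow> x = y) \<and>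
     (\<forall>a S. (a, S) |\<in>| C \<longrightarrow> (\<exists>x'. (x, x') \<in> \<rho> a \<and> sat \<rho> S x' y))"
  by (subst sat_iff) simp

declare sat.simps [simp del]

text \<open>A map of \<open>T\<close> into the graph, composed with a homomorphism from
  \<open>S\<close> to \<open>T\<close>, is a map of \<open>S\<close> into the graph with the same
  root and endpoint.\<close>

lemma sat_antimono: "sat \<rho> T x y \<Longrightarrow> T \<preceq> S \<Longrightarrow> sat \<rho> S x y"
proof (induction S arbitrary: T x rule: ltree_induct)
  case (Node b C)
  show ?case unfolding sat_Node
  proof (intro conjI allI impI)
    show "x = y" if b using that Node.prems tree_le_iff[of T "Node b C"] sat_iff[of \<rho> T x y] by simp
  next
    fix a S assume S: "(a, S) |\<in>| C"
    then obtain T' where T': "(a, T') |\<in>| children T" "T' \<preceq> S"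
      using iffD1[OF tree_le_iff Node.prems(2)] by auto
    then obtain x' where "(x, x') \<in> \<rho> a" "sat \<rho> T' x' y"
      using iffD1[OF sat_iff Node.prems(1)] by blast
    then show "\<exists>x'. (x, x') \<in> \<rho> a \<and> sat \<rho> S x' y" using Node.IH[OF S _ T'(2)] by blast
  qed
qed

lemma sat_reduce: "sat \<rho> (reduce T) x y \<longleftrightarrow> sat \<rho> T x y"
  using sat_antimono reduce_equiv by metis

text \<open>The endpoint constrains marked vertices only.\<close>

lemma sat_unmarked: "points T = {} \<Longrightarrow> sat \<rho> T x y \<Longrightarrow> sat \<rho> T x z"
proof (induction T arbitrary: x rule: ltree_induct)
  case (Node b C)
  have "\<not> b" "\<And>a S. (a, S) |\<in>| C \<Longrightarrow> points S = {}"
    using Node.prems(1) by (auto simp: points_empty_iff)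
  then show ?case using Node.IH Node.prems(2) unfolding sat_Node by metis
qed

section \<open>Denotations of composition and domain\<close>

lemma pointed_NodeE:
  assumes "pointed (Node b C)"
  obtains "b" "\<And>a S. (a, S) |\<in>| C \<Longrightarrow> points S = {}"
  | a T where "\<not> b" "(a, T) |\<in>| C" "pointed T"
      "\<And>c S. (c, S) |\<in>| C \<Longrightarrow> (c, S) \<noteq> (a, T) \<Longrightarrow> points S = {}"
proof (cases b)
  case True
  then show ?thesis using assms that(1) by (auto simp: pointed_Node_True)
next
  case False
  then obtain e where "e |\<in>| C" "pointed (snd e)"
    "\<And>e'. e' |\<in>| C \<Longrightarrow> e' \<noteq> e \<Longrightarrow> points (snd e') = {}"
    using assms by (metis (full_types) pointed_Node_False)
  then show ?thesis using False that(2)[of "fst e" "snd e"]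
    by (metis prod.collapse snd_conv)
qed

lemma all_children_split:
  assumes "(a, T) |\<in>| C"
    and "\<And>c U. (c, U) |\<in>| C \<Longrightarrow> (c, U) \<noteq> (a, T) \<Longrightarrow> P c U \<longleftrightarrow> Q c U"
  shows "(\<forall>c U. (c, U) |\<in>| C \<longrightarrow> P c U) \<longleftrightarrow>
    P a T \<and> (\<forall>c U. (c, U) |\<in>| C \<longrightarrow> (c, U) \<noteq> (a, T) \<longrightarrow> Q c U)"
  using assms by blast

text \<open>Only the child with the point sees the endpoint \<open>y\<close>, so the other children
  may be given any \<open>z\<close>. This takes them out of the scope of the quantifier over
  \<open>y\<close> in \<open>sat_glue\<close> and \<open>sat_unmark\<close>.\<close>

lemma sat_pointed_Node_False:
  assumes "(a, T) |\<in>| C" and "\<And>c S. (c, S) |\<in>| C \<Longrightarrow> (c, S) \<noteq> (a, T) \<Longrightarrow> points S = {}"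
  shows "sat \<rho> (Node False C) x y \<longleftrightarrow>
    (\<exists>x'. (x, x') \<in> \<rho> a \<and> sat \<rho> T x' y) \<and>
    (\<forall>c S. (c, S) |\<in>| C \<longrightarrow> (c, S) \<noteq> (a, T) \<longrightarrow> (\<exists>x'. (x, x') \<in> \<rho> c \<and> sat \<rho> S x' z))"
proof -
  have "(\<exists>x'. (x, x') \<in> \<rho> c \<and> sat \<rho> S x' y) \<longleftrightarrow> (\<exists>x'. (x, x') \<in> \<rho> c \<and> sat \<rho> S x' z)"
    if "(c, S) |\<in>| C" "(c, S) \<noteq> (a, T)" for c S
    using assms(2)[OF that] sat_unmarked[of S \<rho>] by blast
  then have "(\<forall>c S. (c, S) |\<in>| C \<longrightarrow> (\<exists>x'. (x, x') \<in> \<rho> c \<and> sat \<rho> S x' y)) \<longleftrightarrow>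
      (\<exists>x'. (x, x') \<in> \<rho> a \<and> sat \<rho> T x' y) \<and>
      (\<forall>c S. (c, S) |\<in>| C \<longrightarrow> (c, S) \<noteq> (a, T) \<longrightarrow> (\<exists>x'. (x, x') \<in> \<rho> c \<and> sat \<rho> S x' z))"
    by (rule all_children_split[OF assms(1)])
  then show ?thesis unfolding sat_Node by simp
qed

text \<open>A map of the glued tree splits at the vertex where the point of \<open>T\<close> meets
  the root of \<open>S\<close>; \<open>y\<close> is the image of that vertex.\<close>

lemma sat_glue: "pointed T \<Longrightarrow> sat \<rho> (glue S T) x z \<longleftrightarrow> (\<exists>y. sat \<rho> T x y \<and> sat \<rho> S y z)"
proof (induction T arbitrary: x rule: ltree_induct)
  case (Node b C)
  from Node.prems show ?case
  proof (cases rule: pointed_NodeE)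
    case 1
    then have g: "glue S (Node b C) = Node (mark S) (C |\<union>| children S)"
      using glue_Node_True Node.prems by simp
    \<comment> \<open>The point is the root here, so the intermediate vertex is \<open>x\<close>.
      The children of \<open>T\<close> have no marks and may exchange the endpoint \<open>z\<close>
      for \<open>x\<close>.\<close>
    have C: "(\<exists>x'. (x, x') \<in> \<rho> a \<and> sat \<rho> U x' z) \<longleftrightarrow> (\<exists>x'. (x, x') \<in> \<rho> a \<and> sat \<rho> U x' x)"
      if "(a, U) |\<in>| C" for a U
      using 1(2)[OF that] sat_unmarked by metis
    have "(\<exists>y. sat \<rho> (Node b C) x y \<and> sat \<rho> S y z) \<longleftrightarrow> sat \<rho> (Node b C) x x \<and> sat \<rho> S x z"
      using 1(1) unfolding sat_Node by blast
    also have "\<dots> \<longleftrightarrow> sat \<rho> (glue S (Node b C)) x z"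
      unfolding g sat_Node sat_iff[of \<rho> S x z] funion_iff using C by metis
    finally show ?thesis by simp
  next
    case (2 a T)
    let ?C = "fimage (map_prod id (glue S)) C"
    have g: "glue S (Node b C) = Node False ?C" using 2 by simp
    have split: "sat \<rho> (Node False C) x y \<longleftrightarrow>
        (\<exists>x'. (x, x') \<in> \<rho> a \<and> sat \<rho> T x' y) \<and>
        (\<forall>c U. (c, U) |\<in>| C \<longrightarrow> (c, U) \<noteq> (a, T) \<longrightarrow> (\<exists>x'. (x, x') \<in> \<rho> c \<and> sat \<rho> U x' z))"
      for y by (rule sat_pointed_Node_False[OF 2(2)]) (rule 2(4))
    have u: "glue S U = U" if "(c, U) |\<in>| C" "(c, U) \<noteq> (a, T)" for c U
      using 2(4) that glue_unmarked by blast
    have "sat \<rho> (Node False ?C) x z \<longleftrightarrow>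
        (\<forall>c U. (c, U) |\<in>| C \<longrightarrow> (\<exists>x'. (x, x') \<in> \<rho> c \<and> sat \<rho> (glue S U) x' z))"
      unfolding sat_Node by fastforce
    also have "\<dots> \<longleftrightarrow> (\<exists>x'. (x, x') \<in> \<rho> a \<and> sat \<rho> (glue S T) x' z) \<and>
        (\<forall>c U. (c, U) |\<in>| C \<longrightarrow> (c, U) \<noteq> (a, T) \<longrightarrow> (\<exists>x'. (x, x') \<in> \<rho> c \<and> sat \<rho> U x' z))"
      by (rule all_children_split[OF 2(2)]) (simp add: u)
    also have "\<dots> \<longleftrightarrow> (\<exists>y. sat \<rho> (Node False C) x y \<and> sat \<rho> S y z)"
      unfolding split Node.IH[OF 2(2,3)] by blast
    finally show ?thesis using g 2(1) by simp
  qed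
qed

lemma sat_unmark: "pointed T \<Longrightarrow> sat \<rho> (unmark T) x z \<longleftrightarrow> (\<exists>y. sat \<rho> T x y)"
proof (induction T arbitrary: x rule: ltree_induct)
  case (Node b C)
  \<comment> \<open>Without marked vertices, unmarking does not affect the denotation and both
    endpoints are arbitrary.\<close>
  have eq: "sat \<rho> (unmark U) x z \<longleftrightarrow> sat \<rho> U x y" if "points U = {}" for U x y
    using that
  proof (induction U arbitrary: x rule: ltree_induct)
    case (Node b C)
    then have "\<not> b" "\<And>a S. (a, S) |\<in>| C \<Longrightarrow> points S = {}"
      by (auto simp: points_empty_iff)
    then show ?case using Node.IH by (fastforce simp: sat_Node)
  qed
  have "sat \<rho> (unmark (Node b C)) x z \<longleftrightarrow>
      (\<forall>c U. (c, U) |\<in>| C \<longrightarrow> (\<exists>x'. (x, x') \<in> \<rho> c \<and> sat \<rho> (unmark U) x' z))"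
    by (fastforce simp: sat_Node)
  also from Node.prems have "\<dots> \<longleftrightarrow> (\<exists>y. sat \<rho> (Node b C) x y)"
  proof (cases rule: pointed_NodeE)
    case 1
    have "(\<exists>x'. (x, x') \<in> \<rho> c \<and> sat \<rho> (unmark U) x' z) \<longleftrightarrow>
        (\<exists>x'. (x, x') \<in> \<rho> c \<and> sat \<rho> U x' x)" if "(c, U) |\<in>| C" for c U
      using eq[OF 1(2)[OF that], of _ x] by simp
    then show ?thesis unfolding sat_Node using 1(1) by blast
  next
    case (2 a T)
    have split: "sat \<rho> (Node False C) x y \<longleftrightarrow>
        (\<exists>x'. (x, x') \<in> \<rho> a \<and> sat \<rho> T x' y) \<and>
        (\<forall>c U. (c, U) |\<in>| C \<longrightarrow> (c, U) \<noteq> (a, T) \<longrightarrow> (\<exists>x'. (x, x') \<in> \<rho> c \<and> sat \<rho> U x' z))"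
      for y by (rule sat_pointed_Node_False[OF 2(2)]) (rule 2(4))
    have "(\<forall>c U. (c, U) |\<in>| C \<longrightarrow> (\<exists>x'. (x, x') \<in> \<rho> c \<and> sat \<rho> (unmark U) x' z)) \<longleftrightarrow>
        (\<exists>x'. (x, x') \<in> \<rho> a \<and> sat \<rho> (unmark T) x' z) \<and>
        (\<forall>c U. (c, U) |\<in>| C \<longrightarrow> (c, U) \<noteq> (a, T) \<longrightarrow> (\<exists>x'. (x, x') \<in> \<rho> c \<and> sat \<rho> U x' z))"
    proof (rule all_children_split[OF 2(2)])
      fix c U assume "(c, U) |\<in>| C" "(c, U) \<noteq> (a, T)"
      then show "(\<exists>x'. (x, x') \<in> \<rho> c \<and> sat \<rho> (unmark U) x' z) \<longleftrightarrow>
          (\<exists>x'. (x, x') \<in> \<rho> c \<and> sat \<rho> U x' z)"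
        using eq[OF 2(4), of c U _ z] by simp
    qed
    also have "\<dots> \<longleftrightarrow> (\<exists>y. sat \<rho> (Node False C) x y)"
      unfolding split Node.IH[OF 2(2,3)] by blast
    finally show ?thesis using 2(1) by simp
  qed
  finally show ?case .
qed

lemma sat_tree_comp:
  "pointed T \<Longrightarrow> sat \<rho> (tree_comp T S) x z \<longleftrightarrow> (\<exists>y. sat \<rho> T x y \<and> sat \<rho> S y z)"
  by (simp add: tree_comp_def sat_reduce sat_glue)

lemma sat_tree_dom:
  assumes "pointed T"
  shows "sat \<rho> (tree_dom T) x z \<longleftrightarrow> x = z \<and> (\<exists>y. sat \<rho> T x y)"
proof -
  have "\<not> mark (unmark T)" by (cases T) simp
  then have "sat \<rho> (tree_dom T) x z \<longleftrightarrow> x = z \<and> sat \<rho> (unmark T) x z"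
    unfolding tree_dom_def sat_reduce sat_Node sat_iff[of \<rho> "unmark T"] by simp
  then show ?thesis by (simp add: sat_unmark[OF assms])
qed

lemma sat_tree_one: "sat \<rho> tree_one x y \<longleftrightarrow> x = y"
  by (simp add: tree_one_def sat_Node)

lemma sat_tree_letter: "sat \<rho> (tree_letter a) x y \<longleftrightarrow> (x, y) \<in> \<rho> a"
  by (simp add: tree_letter_def sat_Node)

text \<open>The path from the root to the point is mapped to a walk from \<open>x\<close> to
  \<open>y\<close>, and each of its edges stays in \<open>X\<close> because its label is in
  \<open>\<Sigma>\<close>.\<close>

lemma sat_pointed_closed:
  assumes "\<And>a. a \<in> \<Sigma> \<Longrightarrow> \<rho> a \<subseteq> X \<times> X"
  shows "pointed T \<Longrightarrow> labels T \<subseteq> \<Sigma> \<Longrightarrow> sat \<rho> T x y \<Longrightarrow> x \<in> X \<Longrightarrow> y \<in> X"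
proof (induction T arbitrary: x rule: ltree_induct)
  case (Node b C)
  from Node.prems(1) show ?case
  proof (cases rule: pointed_NodeE)
    case 1
    then show ?thesis using Node.prems(3,4) unfolding sat_Node by blast
  next
    case (2 a T)
    obtain x' where x': "(x, x') \<in> \<rho> a" "sat \<rho> T x' y"
      using Node.prems(3) 2(2) unfolding sat_Node by blast
    have l: "a \<in> \<Sigma>" "labels T \<subseteq> \<Sigma>"
      using Node.prems(2) 2(2) labels_iff[of _ "Node b C"] by (metis ltree.sel(2) subset_iff)+
    then have "x' \<in> X" using assms x'(1) by blast
    then show ?thesis using Node.IH[OF 2(2,3) l(2) x'(2)] by blast
  qed
qed

section \<open>Denotations of sets of trees\<close>

definition lang_sem :: "'c set \<Rightarrow> ('a \<Rightarrow> 'c rel) \<Rightarrow> 'a ltree set \<Rightarrow> 'c rel" where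
  "lang_sem X \<rho> L = {(x, y). x \<in> X \<and> y \<in> X \<and> (\<exists>T \<in> L. sat \<rho> T x y)}"

lemma lang_sem_empty: "lang_sem X \<rho> {} = {}"
  by (simp add: lang_sem_def)

text \<open>A discarded tree lies below a maximal one, whose denotation contains that of the
  discarded tree.\<close>

lemma lang_sem_maximal:
  assumes "L \<subseteq> \<R> \<Sigma>"
  shows "lang_sem X \<rho> (maximal L) = lang_sem X \<rho> L"
proof -
  have "\<exists>S \<in> maximal L. sat \<rho> S x y" if "T \<in> L" "sat \<rho> T x y" for T x y
    using maximal_above[of L T] assms that sat_antimono by (fastforce simp: reduced_ptrees_def)
  then show ?thesis using maximal_subset[of L] unfolding lang_sem_def by blast
qed

locale rel_interpretation =
  fixes \<Sigma> :: "'a set" and X :: "'c set" and \<rho> :: "'a \<Rightarrow> 'c rel"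
  assumes interp_subset: "a \<in> \<Sigma> \<Longrightarrow> \<rho> a \<subseteq> X \<times> X"
begin

abbreviation sem :: "'a ltree set \<Rightarrow> 'c rel" where
  "sem \<equiv> lang_sem X \<rho>"

lemma sem_set_comp:
  assumes "L \<subseteq> \<R> \<Sigma>"
  shows "sem (set_comp L M) = sem L O sem M"
proof -
  \<comment> \<open>\<open>sat\<close> lets the intermediate vertex range over the whole type,
    whereas composing the two denotations requires it to be in \<open>X\<close>.\<close>
  have "y \<in> X" if "T \<in> L" "sat \<rho> T x y" "x \<in> X" for T x y
    using sat_pointed_closed[of \<Sigma> \<rho> X T x y] interp_subset that assms
    by (auto simp: reduced_ptrees_def)
  moreover have "pointed T" if "T \<in> L" for T using that assms by (auto simp: reduced_ptrees_def)
  ultimately have "(x, z) \<in> sem (set_comp L M) \<longleftrightarrow> (x, z) \<in> sem L O sem M" for x z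
    unfolding lang_sem_def set_comp_def relcomp_unfold using sat_tree_comp[of _ \<rho> _ x z]
    by simp blast
  then show ?thesis by auto
qed

text \<open>The restriction to \<open>X\<close> in \<open>lang_sem\<close> matters here:
  \<open>tree_one\<close> alone relates every element of the type to itself.\<close>

lemma sem_one: "sem {tree_one} = Id_on X"
  by (auto simp: lang_sem_def sat_tree_one)

lemma sem_letter: "a \<in> \<Sigma> \<Longrightarrow> sem {tree_letter a} = \<rho> a"
  using interp_subset by (auto simp: lang_sem_def sat_tree_letter)

lemma sem_plus: "L \<subseteq> \<R> \<Sigma> \<Longrightarrow> M \<subseteq> \<R> \<Sigma> \<Longrightarrow> sem (lang_plus L M) = sem L \<union> sem M"
  unfolding lang_plus_def using lang_sem_maximal[of "L \<union> M" \<Sigma> X \<rho>] by (auto simp: lang_sem_def)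

lemma sem_comp: "L \<subseteq> \<R> \<Sigma> \<Longrightarrow> M \<subseteq> \<R> \<Sigma> \<Longrightarrow> sem (lang_comp L M) = sem L O sem M"
  unfolding lang_comp_def
  using lang_sem_maximal[of "set_comp L M" \<Sigma> X \<rho>] sem_set_comp set_comp_subset_R by metis

lemma sem_dom:
  assumes "L \<subseteq> \<R> \<Sigma>"
  shows "sem (lang_dom L) = {(x, x) | x. \<exists>y. (x, y) \<in> sem L}"
proof -
  have "y \<in> X" if "T \<in> L" "sat \<rho> T x y" "x \<in> X" for T x y
    using sat_pointed_closed[of \<Sigma> \<rho> X T x y] interp_subset that assms
    by (auto simp: reduced_ptrees_def)
  moreover have "pointed T" if "T \<in> L" for T using that assms by (auto simp: reduced_ptrees_def)
  ultimately have "sem (tree_dom ` L) = {(x, x) | x. \<exists>y. (x, y) \<in> sem L}"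
    unfolding lang_sem_def by (auto simp: sat_tree_dom) blast
  moreover have "tree_dom ` L \<subseteq> \<R> \<Sigma>" using assms tree_dom_in_R by blast
  ultimately show ?thesis unfolding lang_dom_def using lang_sem_maximal by metis
qed

lemma sem_star:
  assumes "L \<subseteq> \<R> \<Sigma>"
  shows "sem (lang_star L) = Id_on X \<union> (sem L)\<^sup>+"
proof -
  \<comment> \<open>The factor \<open>Id_on X\<close> accounts for the power zero:
    \<open>sem L ^^ 0\<close> is the identity on the whole type, while \<open>sem {tree_one}\<close>
    is the identity on \<open>X\<close>.\<close>
  have pow: "sem (set_power L i) = Id_on X O sem L ^^ i" for i
  proof (induction i)
    case (Suc i)
    then show ?case using sem_set_comp[OF set_power_subset_R[OF assms], of i L]
      by (simp add: O_assoc)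
  qed (simp add: sem_one)
  have "sem L \<subseteq> X \<times> X" by (auto simp: lang_sem_def)
  then have "(sem L)\<^sup>+ \<subseteq> X \<times> X" by (rule trancl_subset_Sigma)
  then have tc: "Id_on X O (sem L)\<^sup>* = Id_on X \<union> (sem L)\<^sup>+"
    by (fastforce simp: rtrancl_eq_or_trancl)
  have "sem (\<Union>i. set_power L i) = (\<Union>i. sem (set_power L i))" by (auto simp: lang_sem_def)
  also have "\<dots> = Id_on X O (\<Union>i. sem L ^^ i)" unfolding pow by blast
  also have "\<dots> = Id_on X O (sem L)\<^sup>*" by (simp add: rtrancl_is_UN_relpow)
  finally have "sem (\<Union>i. set_power L i) = Id_on X \<union> (sem L)\<^sup>+" using tc by simp
  moreover have "(\<Union>i. set_power L i) \<subseteq> \<R> \<Sigma>" using set_power_subset_R[OF assms] by blast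
  ultimately show ?thesis unfolding lang_star_def using lang_sem_maximal by metis
qed

end


section \<open>The algebra of regular sets\<close>

lemma univ_regular: "univ (regular_tree_algebra \<Sigma>) = {\<lbrakk>t\<rbrakk> | t. letters t \<subseteq> \<Sigma>}"
  using tree_interp_subset_R by (auto simp: regular_tree_algebra_def regular_def)

lemma univ_regular_subset: "L \<in> univ (regular_tree_algebra \<Sigma>) \<Longrightarrow> L \<subseteq> \<R> \<Sigma>"
  by (simp add: regular_tree_algebra_def)

lemma regular_tree_algebra_sel [simp]:
  "comp_op (regular_tree_algebra \<Sigma>) = lang_comp"
  "plus_op (regular_tree_algebra \<Sigma>) = lang_plus"
  "star_op (regular_tree_algebra \<Sigma>) = lang_star"
  "zero_op (regular_tree_algebra \<Sigma>) = {}"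
  "one_op (regular_tree_algebra \<Sigma>) = {tree_one}"
  "dom_op (regular_tree_algebra \<Sigma>) = lang_dom"
  by (simp_all add: regular_tree_algebra_def)

lemma tree_interp_in_univ: "letters t \<subseteq> \<Sigma> \<Longrightarrow> \<lbrakk>t\<rbrakk> \<in> univ (regular_tree_algebra \<Sigma>)"
  by (auto simp: univ_regular)

lemma letter_in_univ: "a \<in> \<Sigma> \<Longrightarrow> {tree_letter a} \<in> univ (regular_tree_algebra \<Sigma>)"
  using tree_interp_in_univ[of "Letter a" \<Sigma>] by simp

lemma kd_algebra_regular: "kd_algebra (regular_tree_algebra \<Sigma>)"
  unfolding kd_algebra_def regular_tree_algebra_sel
proof (intro conjI ballI)
  let ?F = "regular_tree_algebra \<Sigma>"
  show "{} \<in> univ ?F" "{tree_one} \<in> univ ?F"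
    using tree_interp_in_univ[of Zero \<Sigma>] tree_interp_in_univ[of One \<Sigma>] by simp_all
  fix L assume "L \<in> univ ?F"
  then obtain s where s: "letters s \<subseteq> \<Sigma>" "L = \<lbrakk>s\<rbrakk>" unfolding univ_regular by blast
  show "lang_star L \<in> univ ?F" "lang_dom L \<in> univ ?F"
    using tree_interp_in_univ[of "Star s" \<Sigma>] tree_interp_in_univ[of "Dom s" \<Sigma>] s by simp_all
  fix M assume "M \<in> univ ?F"
  then obtain t where t: "letters t \<subseteq> \<Sigma>" "M = \<lbrakk>t\<rbrakk>" unfolding univ_regular by blast
  show "lang_comp L M \<in> univ ?F" "lang_plus L M \<in> univ ?F"
    using tree_interp_in_univ[of "Comp s t" \<Sigma>] tree_interp_in_univ[of "Plus s t" \<Sigma>] s t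
    by simp_all
qed

lemma kd_homI:
  assumes "h \<in> univ A \<rightarrow>\<^sub>E univ B" "h (zero_op A) = zero_op B" "h (one_op A) = one_op B"
    and "\<And>x y. x \<in> univ A \<Longrightarrow> y \<in> univ A \<Longrightarrow> h (comp_op A x y) = comp_op B (h x) (h y)"
    and "\<And>x y. x \<in> univ A \<Longrightarrow> y \<in> univ A \<Longrightarrow> h (plus_op A x y) = plus_op B (h x) (h y)"
    and "\<And>x. x \<in> univ A \<Longrightarrow> h (star_op A x) = star_op B (h x)"
    and "\<And>x. x \<in> univ A \<Longrightarrow> h (dom_op A x) = dom_op B (h x)"
  shows "h \<in> kd_hom A B"
  using assms unfolding kd_hom_def mem_Collect_eq by blast

lemma kd_homD:
  assumes "h \<in> kd_hom A B"
  shows "h \<in> univ A \<rightarrow>\<^sub>E univ B" "h (zero_op A) = zero_op B" "h (one_op A) = one_op B"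
    and "\<And>x y. x \<in> univ A \<Longrightarrow> y \<in> univ A \<Longrightarrow> h (comp_op A x y) = comp_op B (h x) (h y)"
    and "\<And>x y. x \<in> univ A \<Longrightarrow> y \<in> univ A \<Longrightarrow> h (plus_op A x y) = plus_op B (h x) (h y)"
    and "\<And>x. x \<in> univ A \<Longrightarrow> h (star_op A x) = star_op B (h x)"
    and "\<And>x. x \<in> univ A \<Longrightarrow> h (dom_op A x) = dom_op B (h x)"
  using assms unfolding kd_hom_def mem_Collect_eq by blast+

lemma kd_algebraD:
  assumes "kd_algebra A"
  shows "zero_op A \<in> univ A" "one_op A \<in> univ A"
    and "\<And>x y. x \<in> univ A \<Longrightarrow> y \<in> univ A \<Longrightarrow> comp_op A x y \<in> univ A"
    and "\<And>x y. x \<in> univ A \<Longrightarrow> y \<in> univ A \<Longrightarrow> plus_op A x y \<in> univ A"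
    and "\<And>x. x \<in> univ A \<Longrightarrow> star_op A x \<in> univ A"
    and "\<And>x. x \<in> univ A \<Longrightarrow> dom_op A x \<in> univ A"
  using assms unfolding kd_algebra_def by blast+

text \<open>An operation applied to images of elements of \<open>A\<close> is the image of the
  operation in \<open>A\<close>, hence again in the image.\<close>

lemma kd_algebra_image:
  assumes A: "kd_algebra A" and h: "h \<in> kd_hom A B" and im: "univ B = h ` univ A"
  shows "kd_algebra B"
  unfolding kd_algebra_def im
  by (intro conjI ballI; (elim imageE)?)
    (simp_all add: kd_algebraD[OF A] flip: kd_homD(2-)[OF h])

text \<open>Every element is the value of a term over \<open>\<Sigma>\<close>, so agreement on
  letters spreads by induction on terms. Off the universe both maps are \<open>undefined\<close>, by
  extensionality of \<open>kd_hom\<close>.\<close>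

lemma kd_hom_letters_unique:
  assumes h: "h \<in> kd_hom (regular_tree_algebra \<Sigma>) A"
    and k: "k \<in> kd_hom (regular_tree_algebra \<Sigma>) A"
    and eq: "\<And>a. a \<in> \<Sigma> \<Longrightarrow> h {tree_letter a} = k {tree_letter a}"
  shows "h = k"
proof (rule PiE_ext[OF kd_homD(1)[OF h] kd_homD(1)[OF k]])
  fix L assume "L \<in> univ (regular_tree_algebra \<Sigma>)"
  then obtain t where "letters t \<subseteq> \<Sigma>" "L = \<lbrakk>t\<rbrakk>" unfolding univ_regular by blast
  moreover have "letters t \<subseteq> \<Sigma> \<Longrightarrow> h \<lbrakk>t\<rbrakk> = k \<lbrakk>t\<rbrakk>" for t
    by (induction t)
      (use kd_homD(2-)[OF h] kd_homD(2-)[OF k] tree_interp_in_univ[of _ \<Sigma>] eq in simp_all)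
  ultimately show "h L = k L" by blast
qed

context rel_interpretation
begin

lemma sem_hom:
  assumes "\<And>L. L \<in> univ (regular_tree_algebra \<Sigma>) \<Longrightarrow> sem L \<in> U"
  shows "restrict sem (univ (regular_tree_algebra \<Sigma>))
    \<in> kd_hom (regular_tree_algebra \<Sigma>) (rel_structure X U)"
proof (rule kd_homI)
  let ?F = "regular_tree_algebra \<Sigma>"
  show "restrict sem (univ ?F) \<in> univ ?F \<rightarrow>\<^sub>E univ (rel_structure X U)"
    using assms by (simp add: rel_structure_def restrict_PiE_iff)
qed (simp_all add: kd_algebraD[OF kd_algebra_regular, simplified] univ_regular_subset
    rel_structure_def sem_one sem_plus sem_comp sem_star sem_dom lang_sem_empty)

text \<open>\<open>U\<close> can be a proper subset of all relations on \<open>X\<close>, so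
  evaluation has to be shown to stay inside it: \<open>U\<close> holds the letters' values and is
  closed under the operations.\<close>

lemma sem_tree_interp_in:
  assumes U: "kd_algebra (rel_structure X U)" and "\<And>a. a \<in> \<Sigma> \<Longrightarrow> \<rho> a \<in> U"
  shows "letters t \<subseteq> \<Sigma> \<Longrightarrow> sem \<lbrakk>t\<rbrakk> \<in> U"
  by (induction t)
    (use kd_algebraD[OF U] assms(2) tree_interp_subset_R[of _ \<Sigma>] in \<open>simp_all add:
      rel_structure_def lang_sem_empty sem_one sem_letter sem_plus sem_comp sem_star sem_dom\<close>)

end


section \<open>Freeness\<close>

text \<open>Each element of \<open>B\<close> has the form \<open>g x\<close>; an operation on such
  elements is pulled inside \<open>g\<close>, where the inverse cancels it.\<close>

lemma kd_hom_inv_into: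
  assumes A: "kd_algebra A" and g: "g \<in> kd_hom A B" "bij_betw g (univ A) (univ B)"
  shows "restrict (inv_into (univ A) g) (univ B) \<in> kd_hom B A"
proof -
  have inj: "inj_on g (univ A)" and im: "univ B = g ` univ A"
    using g(2) by (auto simp: bij_betw_def)
  have i: "inv_into (univ A) g (g x) = x" if "x \<in> univ A" for x
    using inj that by simp
  have c: "g x \<in> univ B" if "x \<in> univ A" for x using im that by blast
  show ?thesis
  proof (rule kd_homI)
    show "restrict (inv_into (univ A) g) (univ B) \<in> univ B \<rightarrow>\<^sub>E univ A"
      using i by (auto simp: restrict_PiE_iff im)
  qed (auto simp: im i c kd_algebraD[OF A] intro!: inj_onD[OF inj] simp flip: kd_homD(2-)[OF g(1)])
qed

lemma kd_hom_compose:
  assumes "kd_algebra A" "h \<in> kd_hom A B" "k \<in> kd_hom B C"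
  shows "restrict (k \<circ> h) (univ A) \<in> kd_hom A C"
proof -
  have "h x \<in> univ B" if "x \<in> univ A" for x using kd_homD(1)[OF assms(2)] that by blast
  moreover have "k x \<in> univ C" if "x \<in> univ B" for x using kd_homD(1)[OF assms(3)] that by blast
  ultimately show ?thesis
    by (intro kd_homI) (simp_all add: kd_algebraD[OF assms(1)] kd_homD(2-)[OF assms(2)]
        kd_homD(2-)[OF assms(3)] restrict_PiE_iff)
qed

text \<open>The required homomorphism evaluates sets of trees in a representation of
  \<open>A\<close> by relations and returns to \<open>A\<close> along the inverse of the
  representing isomorphism \<open>g\<close>.\<close>

lemma regular_tree_algebra_extends_uniquely:
  fixes A :: "'b kd_structure" and \<Sigma> :: "'a set"
  assumes "A \<in> Rel TYPE('c)"
  shows "extends_uniquely (regular_tree_algebra \<Sigma>) \<Sigma> (\<lambda>a. {tree_letter a}) A"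
  unfolding extends_uniquely_def
proof
  fix f assume f: "f \<in> \<Sigma> \<rightarrow> univ A"
  let ?F = "regular_tree_algebra \<Sigma>"
  obtain X :: "'c set" and U g where A: "kd_algebra A" and U: "U \<subseteq> Pow (X \<times> X)"
    "kd_algebra (rel_structure X U)" and g: "g \<in> kd_hom A (rel_structure X U)"
    "bij_betw g (univ A) (univ (rel_structure X U))"
    using assms unfolding Rel_def kd_isomorphic_def by blast
  have gU: "g x \<in> U" if "x \<in> univ A" for x
    using g(2) that by (auto simp: bij_betw_def rel_structure_def)
  \<comment> \<open>The letter \<open>a\<close> is interpreted by the relation that represents its
    prescribed value \<open>f a\<close>.\<close>
  interpret rel_interpretation \<Sigma> X "\<lambda>a. g (f a)"
    using f gU U by unfold_locales blast
  have semU: "sem L \<in> U" if L: "L \<in> univ ?F" for L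
  proof -
    obtain t where t: "letters t \<subseteq> \<Sigma>" "L = \<lbrakk>t\<rbrakk>" using L unfolding univ_regular by blast
    show ?thesis unfolding t(2) by (rule sem_tree_interp_in[OF U(2) _ t(1)]) (use f gU in blast)
  qed
  define i where "i = restrict (inv_into (univ A) g) (univ (rel_structure X U))"
  define h where "h = restrict (i \<circ> restrict sem (univ ?F)) (univ ?F)"
  have hom: "h \<in> kd_hom ?F A"
    unfolding h_def i_def
    using kd_hom_compose[OF kd_algebra_regular sem_hom[OF semU] kd_hom_inv_into[OF A g]] .
  have ext: "h {tree_letter a} = f a" if a: "a \<in> \<Sigma>" for a
  proof -
    have fa: "f a \<in> univ A" using f a by blast
    have "h {tree_letter a} = i (g (f a))"
      using letter_in_univ[OF a] sem_letter[OF a] by (simp add: h_def)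
    also have "\<dots> = inv_into (univ A) g (g (f a))"
      using gU[OF fa] by (simp add: i_def rel_structure_def)
    also have "\<dots> = f a" using g(2) fa by (simp add: bij_betw_def)
    finally show ?thesis .
  qed
  show "\<exists>!h. h \<in> kd_hom ?F A \<and> (\<forall>a\<in>\<Sigma>. h {tree_letter a} = f a)"
  proof (rule ex1I[of _ h])
    show "h \<in> kd_hom ?F A \<and> (\<forall>a\<in>\<Sigma>. h {tree_letter a} = f a)" using hom ext by blast
    fix k assume k: "k \<in> kd_hom ?F A \<and> (\<forall>a\<in>\<Sigma>. k {tree_letter a} = f a)"
    show "k = h" by (rule kd_hom_letters_unique[OF conjunct1[OF k] hom]) (use k ext in simp)
  qed
qed


section \<open>Representability\<close>

text \<open>
  Equal subtrees of \<open>T\<close> are a single vertex of the graph \<open>child_rel\<close>, but unfolding the graph from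
  \<open>T\<close> gives back \<open>T\<close>. Since a pointed tree \<open>T\<close> contains only one subtree \<open>y\<close> with a marked root,
  sending the point of \<open>S\<close> to \<open>y\<close> is the same as sending it to the point of \<open>T\<close>.
\<close>

definition child_rel :: "'a \<Rightarrow> 'a ltree rel" where
  "child_rel a = {(T, S). (a, S) |\<in>| children T}"

text \<open>Edges of the graph descend to child subtrees, so a map of \<open>S\<close> that starts
  at \<open>T\<close> traces a homomorphism into \<open>T\<close>. Marks are preserved because
  marked vertices go to \<open>y\<close>, which is marked.\<close>

lemma sat_child_rel_imp_le: "sat child_rel S T y \<Longrightarrow> mark y \<Longrightarrow> T \<preceq> S"
proof (induction S arbitrary: T rule: ltree_induct)
  case (Node b C)
  show ?case
    using Node.prems Node.IH unfolding sat_Node tree_le_iff[of T] child_rel_def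
    by simp blast
qed

text \<open>Each vertex is sent to the subtree hanging at it; the hypothesis makes all marked
  vertices arrive at \<open>y\<close>.\<close>

lemma sat_child_rel_self:
  assumes "\<And>p. p \<in> points T \<Longrightarrow> subtree_at T p = y"
  shows "sat child_rel T T y"
  using assms
proof (induction T rule: ltree_induct)
  case (Node b C)
  have "Node b C = y" if b using Node.prems[of "[]"] that by simp
  moreover have "sat child_rel S S y" if S: "(a, S) |\<in>| C" for a S
  proof (rule Node.IH[OF S])
    fix p assume "p \<in> points S"
    then show "subtree_at S p = y" using Node.prems[of "(a, S) # p"] S by simp
  qed
  ultimately show ?case unfolding sat_Node child_rel_def by auto
qed

text \<open>The witness \<open>y\<close> is the subtree of \<open>T\<close> at its point. One
  direction is \<open>sat_child_rel_imp_le\<close>; the other transfers the canonical map of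
  \<open>T\<close> to every \<open>S\<close> above it by \<open>sat_antimono\<close>.\<close>

lemma point_subtree:
  assumes "pointed T"
  obtains y where "mark y" "\<And>S. sat child_rel S T y \<longleftrightarrow> T \<preceq> S"
proof -
  obtain p where p: "p \<in> points T" "\<And>q. q \<in> points T \<Longrightarrow> q = p"
    using assms unfolding pointed_def by blast
  have "mark (subtree_at T p)" using p(1) by (simp add: points_def)
  moreover have "sat child_rel T T (subtree_at T p)"
    by (rule sat_child_rel_self) (metis p(2))
  ultimately show ?thesis using that sat_child_rel_imp_le sat_antimono by metis
qed

text \<open>The pair of \<open>T\<close> and its subtree \<open>y\<close> at the point is a test
  pair: it lies in the denotation of a set exactly when \<open>T\<close> is below a member of that
  set.\<close>

lemma lang_sem_child_rel_below:
  assumes "lang_sem UNIV child_rel L \<subseteq> lang_sem UNIV child_rel M" "T \<in> L" "pointed T"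
  shows "\<exists>S \<in> M. T \<preceq> S"
proof -
  obtain y where y: "\<And>S. sat child_rel S T y \<longleftrightarrow> T \<preceq> S" using point_subtree[OF assms(3)] by metis
  then have "sat child_rel T T y" by simp
  then have "(T, y) \<in> lang_sem UNIV child_rel L" using assms(2) unfolding lang_sem_def by blast
  then have "(T, y) \<in> lang_sem UNIV child_rel M" using assms(1) by blast
  then show ?thesis using y by (auto simp: lang_sem_def)
qed

text \<open>Testing in both directions gives \<open>T \<preceq> S \<preceq> T'\<close> with
  \<open>S\<close> in \<open>M\<close> and \<open>T'\<close> in \<open>L\<close>. As
  \<open>L\<close> is an antichain, \<open>T' = T\<close>, and antisymmetry yields
  \<open>S = T\<close>.\<close>

lemma maximal_subset_of_lang_sem:
  assumes "lang_sem UNIV child_rel L = lang_sem UNIV child_rel M"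
    and "L \<subseteq> \<R> \<Sigma>" "M \<subseteq> \<R> \<Sigma>" "maximal L = L"
  shows "L \<subseteq> M"
proof
  fix T assume T: "T \<in> L"
  obtain S where S: "S \<in> M" "T \<preceq> S"
    using lang_sem_child_rel_below[of L M T] assms T by (auto simp: reduced_ptrees_def)
  obtain T' where T': "T' \<in> L" "S \<preceq> T'"
    using lang_sem_child_rel_below[of M L S] assms S by (auto simp: reduced_ptrees_def)
  have "T' = T" using tree_le_trans[OF S(2) T'(2)] T T'(1) assms(4) unfolding maximal_def by blast
  then have "S = T" using reduced_antisym[of T S] S T T' assms(2,3) by (auto simp: reduced_ptrees_def)
  then show "T \<in> M" using S by simp
qed

lemma regular_tree_algebra_in_Rel:
  fixes \<Sigma> :: "'a set"
  shows "regular_tree_algebra \<Sigma> \<in> Rel TYPE('a ltree)"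
proof -
  let ?F = "regular_tree_algebra \<Sigma>"
  interpret rel_interpretation \<Sigma> "UNIV :: 'a ltree set" child_rel
    by unfold_locales simp
  let ?h = "restrict sem (univ ?F)"
  \<comment> \<open>Taking exactly the denotations of regular sets as universe makes
    \<open>sem\<close> surjective, so only its injectivity remains to be shown for an
    isomorphism.\<close>
  let ?U = "sem ` univ ?F"
  have h: "?h \<in> kd_hom ?F (rel_structure UNIV ?U)" by (rule sem_hom) blast
  have "inj_on sem (univ ?F)"
  proof (rule inj_onI)
    fix L M assume LM: "L \<in> univ ?F" "M \<in> univ ?F" and eq: "sem L = sem M"
    then have "maximal L = L" "maximal M = M" by (auto simp: univ_regular maximal_tree_interp)
    then show "L = M"
      using maximal_subset_of_lang_sem[OF eq] maximal_subset_of_lang_sem[OF eq[symmetric]]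
        univ_regular_subset LM by blast
  qed
  then have "bij_betw ?h (univ ?F) (univ (rel_structure UNIV ?U))"
    by (auto simp: bij_betw_def inj_on_def rel_structure_def)
  moreover have "kd_algebra (rel_structure UNIV ?U)"
    by (rule kd_algebra_image[OF kd_algebra_regular h]) (simp add: rel_structure_def)
  moreover have "?U \<subseteq> Pow (UNIV \<times> UNIV)" by simp
  ultimately show ?thesis
    using h kd_algebra_regular[of \<Sigma>] unfolding Rel_def kd_isomorphic_def mem_Collect_eq by blast
qed

theorem theorem5p6:
  fixes \<Sigma> :: "'a set"
  shows "regular_tree_algebra \<Sigma> \<in> Rel TYPE('a ltree) \<and>
    (\<forall>a \<in> \<Sigma>. {tree_letter a} \<in> univ (regular_tree_algebra \<Sigma>)) \<and>
    (\<forall>A :: 'b kd_structure. A \<in> Rel TYPE('c) \<longrightarrow>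
       extends_uniquely (regular_tree_algebra \<Sigma>) \<Sigma> (\<lambda>a. {tree_letter a}) A)"
  by (intro conjI ballI allI impI regular_tree_algebra_in_Rel letter_in_univ
      regular_tree_algebra_extends_uniquely)

end
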